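(* Let $\mathcal{S}:(\mathbb{R},\leq)\to \mathbf{DGI}$ be a functor (a persistence differential graded inner product space), and for real numbers $a\leq b$ let $f_{a\to b}:\mathcal{S}_a\to\mathcal{S}_b$ be the morphism induced by $a\to b$. For any $a\leq b$ there is a direct sum decomposition of inner product spaces $$\mathcal{S}_{a}= \ker \Delta^{a,b}_{\mathcal{S}}\oplus \operatorname{im} \left(f_{a\to b}^{*}d\iota\iota^{*}d^{*}f_{a\to b}\right)\oplus \operatorname{im} d^{*}d,$$ where $\ker \Delta^{a,b}_{\mathcal{S}}\cong\mathcal{H}^{a,b}(\mathcal{S})$.
   Context: All vector spaces are real. A differential graded inner product space is a finite-dimensional graded vector space $V=\bigoplus_p V_p$ with a differential $d:V_p\to V_{p-1}$, $d^2=0$, and an inner product such that $V_i\perp V_j$ for $i\neq j$. A morphism $f:V\to W$ is a (degree-preserving) chain map with $\langle x,y\rangle_V=\langle f(x),f(y)\rangle_W$ for all $x,y$. $\mathbf{DGI}$ is the resulting category. $(\mathbb{R},\leq)$ is the poset of reals regarded as a category. A superscript $*$ denotes the adjoint of a linear map. A direct sum decomposition of inner product spaces is an orthogonal direct sum decomposition. For real numbers $a\leq b$, let $\iota:\{x\in\mathcal{S}_b\mid dx\in f_{a\to b}(\mathcal{S}_a)\}\hookrightarrow\mathcal{S}_b$ be the inclusion of the indicated subspace (with the restricted inner product). The $(a,b)$-persistent Laplacian is $$\Delta^{a,b}_{\mathcal{S}}=f_{a\to b}^{*}d\iota\iota^{*}d^{*}f_{a\to b}+d^{*}d:\mathcal{S}_a\to\mathcal{S}_a.$$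 For $V\in\mathbf{DGI}$ let $\mathcal{H}=\ker d\cap\ker d^*$ and let $h:V\to V$ be the orthogonal projection onto $\mathcal{H}$, coming from the Hodge decomposition $V=dV\oplus d^*V\oplus\mathcal{H}$. The $(a,b)$-persistent harmonic space of $\mathcal{S}$ is $\mathcal{H}^{a,b}(\mathcal{S})=h f_{a\to b}h(\mathcal{S}_a)\subseteq\mathcal{S}_b$. The isomorphism $\cong$ is in the category $\mathbf{Inn}$ of inner product spaces and linear maps. *)

theory Defs
  imports "HOL-Analysis.Analysis"
begin

text \<open>
  All inner product spaces are linear subspaces of one ambient real inner product space
  \<open>'a\<close>, with the restricted inner product.  The ambient type is arbitrary and need not be
  finite-dimensional or complete, so that any family of finite-dimensional inner product
  spaces can be realised in a suitable \<open>'a\<close> (for instance in the direct sum of the family).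
  A linear map between subspaces is a function on \<open>'a\<close> of which only the values on the source
  subspace matter.
\<close>

definition linear_between :: "'a::real_vector set \<Rightarrow> 'b::real_vector set \<Rightarrow> ('a \<Rightarrow> 'b) \<Rightarrow> bool"
  where "linear_between V W f \<longleftrightarrow>
    (\<forall>x\<in>V. f x \<in> W) \<and>
    (\<forall>x\<in>V. \<forall>y\<in>V. f (x + y) = f x + f y) \<and>
    (\<forall>c. \<forall>x\<in>V. f (c *\<^sub>R x) = c *\<^sub>R f x)"

definition isomorphic_Inn :: "'a::real_inner set \<Rightarrow> 'b::real_inner set \<Rightarrow> bool"
  where "isomorphic_Inn V W \<longleftrightarrow>
    (\<exists>\<phi> \<psi>. linear_between V W \<phi> \<and> linear_between W V \<psi> \<and>
      (\<forall>x\<in>V. \<psi> (\<phi> x) = x) \<and> (\<forall>y\<in>W. \<phi> (\<psi> y) = y))"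

text \<open>
  Pairwise orthogonality makes the sum of the subspaces \<open>U i\<close> automatically direct.
  The equation with the span says that the (finite) sums of elements of the \<open>U i\<close> exhaust \<open>V\<close>.
\<close>

definition orthogonal_direct_sum :: "'i set \<Rightarrow> ('i \<Rightarrow> 'a::real_inner set) \<Rightarrow> 'a set \<Rightarrow> bool"
  where "orthogonal_direct_sum I U V \<longleftrightarrow>
    (\<forall>i\<in>I. subspace (U i)) \<and>
    (\<forall>i\<in>I. \<forall>j\<in>I. i \<noteq> j \<longrightarrow> (\<forall>x\<in>U i. \<forall>y\<in>U j. orthogonal x y)) \<and>
    V = span (\<Union>i\<in>I. U i)"

text \<open>
  The adjoint of a linear map \<open>f : V \<rightarrow> W\<close>, as a function \<open>W \<rightarrow> V\<close>; it depends on the source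
  \<open>V\<close>, while \<open>W\<close> only delimits the arguments \<open>y\<close> of interest.  For finite-dimensional \<open>V\<close> the
  described element exists and is unique.
\<close>

definition adjoint_on :: "'a::real_inner set \<Rightarrow> ('a \<Rightarrow> 'b::real_inner) \<Rightarrow> 'b \<Rightarrow> 'a"
  where "adjoint_on V f y = (THE x. x \<in> V \<and> (\<forall>v\<in>V. f v \<bullet> y = v \<bullet> x))"

definition kernel_on :: "'a set \<Rightarrow> ('a \<Rightarrow> 'b::zero) \<Rightarrow> 'a set"
  where "kernel_on V f = {x \<in> V. f x = 0}"

definition orth_projection :: "'a::real_inner set \<Rightarrow> 'a \<Rightarrow> 'a"
  where "orth_projection U x = (THE u. u \<in> U \<and> (\<forall>v\<in>U. orthogonal (x - u) v))"

record 'a dg_space =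
  grade :: "int \<Rightarrow> 'a set"
  bdry :: "'a \<Rightarrow> 'a"

definition total_space :: "'a::real_inner dg_space \<Rightarrow> 'a set"
  where "total_space V = span (\<Union>p. grade V p)"

definition dgi :: "'a::real_inner dg_space \<Rightarrow> bool"
  where "dgi V \<longleftrightarrow>
    orthogonal_direct_sum UNIV (grade V) (total_space V) \<and>
    (\<exists>B. finite B \<and> total_space V = span B) \<and>
    linear_between (total_space V) (total_space V) (bdry V) \<and>
    (\<forall>p. \<forall>x\<in>grade V p. bdry V x \<in> grade V (p - 1)) \<and>
    (\<forall>x\<in>total_space V. bdry V (bdry V x) = 0)"

definition dgi_morphism ::
    "'a::real_inner dg_space \<Rightarrow> 'b::real_inner dg_space \<Rightarrow> ('a \<Rightarrow> 'b) \<Rightarrow> bool"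
  where "dgi_morphism V W f \<longleftrightarrow>
    linear_between (total_space V) (total_space W) f \<and>
    (\<forall>p. \<forall>x\<in>grade V p. f x \<in> grade W p) \<and>
    (\<forall>x\<in>total_space V. f (bdry V x) = bdry W (f x)) \<and>
    (\<forall>x\<in>total_space V. \<forall>y\<in>total_space V. x \<bullet> y = f x \<bullet> f y)"

text \<open>
  A functor from the poset of reals to \<open>DGI\<close>.  The map \<open>f a b\<close> is meaningful for \<open>a \<le> b\<close> only,
  and morphisms are compared on their source.
\<close>

definition persistence_dgi ::
    "(real \<Rightarrow> 'a::real_inner dg_space) \<Rightarrow> (real \<Rightarrow> real \<Rightarrow> 'a \<Rightarrow> 'a) \<Rightarrow> bool"
  where "persistence_dgi S f \<longleftrightarrow>
    (\<forall>a. dgi (S a)) \<and>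
    (\<forall>a b. a \<le> b \<longrightarrow> dgi_morphism (S a) (S b) (f a b)) \<and>
    (\<forall>a. \<forall>x\<in>total_space (S a). f a a x = x) \<and>
    (\<forall>a b c. a \<le> b \<longrightarrow> b \<le> c \<longrightarrow> (\<forall>x\<in>total_space (S a). f a c x = f b c (f a b x)))"

definition bdry_adj :: "'a::real_inner dg_space \<Rightarrow> 'a \<Rightarrow> 'a"
  where "bdry_adj V = adjoint_on (total_space V) (bdry V)"

definition persistent_dom ::
    "(real \<Rightarrow> 'a::real_inner dg_space) \<Rightarrow> (real \<Rightarrow> real \<Rightarrow> 'a \<Rightarrow> 'a) \<Rightarrow> real \<Rightarrow> real \<Rightarrow> 'a set"
  where "persistent_dom S f a b =
    {x \<in> total_space (S b). bdry (S b) x \<in> f a b ` total_space (S a)}"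

text \<open>
  The operator \<open>f* d \<iota> \<iota>* d* f\<close>.  Since subspaces share the ambient type, the inclusion \<open>\<iota>\<close> of
  \<^const>\<open>persistent_dom\<close> into the space at \<open>b\<close> is the identity function; its adjoint is taken with
  respect to the source \<^const>\<open>persistent_dom\<close>.
\<close>

definition persistent_up ::
    "(real \<Rightarrow> 'a::real_inner dg_space) \<Rightarrow> (real \<Rightarrow> real \<Rightarrow> 'a \<Rightarrow> 'a) \<Rightarrow> real \<Rightarrow> real \<Rightarrow> 'a \<Rightarrow> 'a"
  where "persistent_up S f a b =
    (let \<iota> = id in
      adjoint_on (total_space (S a)) (f a b) \<circ> bdry (S b) \<circ>
      \<iota> \<circ> adjoint_on (persistent_dom S f a b) \<iota> \<circ>
      bdry_adj (S b) \<circ> f a b)"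

definition persistent_laplacian ::
    "(real \<Rightarrow> 'a::real_inner dg_space) \<Rightarrow> (real \<Rightarrow> real \<Rightarrow> 'a \<Rightarrow> 'a) \<Rightarrow> real \<Rightarrow> real \<Rightarrow> 'a \<Rightarrow> 'a"
  where "persistent_laplacian S f a b x =
    persistent_up S f a b x + bdry_adj (S a) (bdry (S a) x)"

definition harmonic :: "'a::real_inner dg_space \<Rightarrow> 'a set"
  where "harmonic V = kernel_on (total_space V) (bdry V) \<inter> kernel_on (total_space V) (bdry_adj V)"

definition harmonic_proj :: "'a::real_inner dg_space \<Rightarrow> 'a \<Rightarrow> 'a"
  where "harmonic_proj V = orth_projection (harmonic V)"

definition persistent_harmonic ::
    "(real \<Rightarrow> 'a::real_inner dg_space) \<Rightarrow> (real \<Rightarrow> real \<Rightarrow> 'a \<Rightarrow> 'a) \<Rightarrow> real \<Rightarrow> real \<Rightarrow> 'a set"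
  where "persistent_harmonic S f a b =
    (harmonic_proj (S b) \<circ> f a b \<circ> harmonic_proj (S a)) ` total_space (S a)"

end

theory Submission imports Defs begin

text \<open>
  Write \<open>V\<close>, \<open>W\<close> for the spaces at \<open>a\<close>, \<open>b\<close>, write \<open>F : V \<rightarrow> W\<close> for the map between them, and
  \<open>P \<subseteq> W\<close> for the space of chains whose boundary lies in \<open>F V\<close>.  Everything follows from viewing
  \<open>A = F* d\<close> and \<open>d\<close> as a two-step complex \<open>P \<rightarrow> V \<rightarrow> V\<close>.  Because \<open>F\<close> is isometric, \<open>A p\<close> is the
  unique preimage of \<open>d p\<close> under \<open>F\<close>; hence \<open>F d A p = d d p = 0\<close>, and so \<open>d A = 0\<close>.  Since
  \<open>A* = \<iota>* d* F\<close>, the persistent Laplacian is the ordinary Hodge Laplacian \<open>A A* + d* d\<close> of this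
  complex, and the decomposition is finite-dimensional Hodge theory
  (\<open>two_step_hodge_decomposition\<close>).

  The kernel consists of the cycles of \<open>V\<close> orthogonal to \<open>im A\<close>, and \<open>im A\<close> is the space of all
  \<open>v\<close> in \<open>V\<close> for which \<open>F v\<close> is a boundary in \<open>W\<close>.  The isomorphism is \<open>h F\<close> restricted to this
  kernel.  It is injective: a cycle of \<open>W\<close> without harmonic part is a boundary
  (\<open>cycle_with_zero_harmonic_proj\<close>), so a kernel element killed by \<open>h F\<close> lies in \<open>im A\<close> and is
  orthogonal to itself.  It has the right image: the kernel is contained in the harmonic space of
  \<open>V\<close>, and a harmonic element of \<open>V\<close> differs from its component orthogonal to \<open>im A\<close>, which lies
  in the kernel, by an element that \<open>F\<close> sends to a boundary and \<open>h\<close> therefore kills.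
\<close>

section \<open>Linear maps on subspaces\<close>

lemma linear_between_mem: "linear_between V W f \<Longrightarrow> x \<in> V \<Longrightarrow> f x \<in> W"
  by (simp add: linear_between_def)

lemma linear_between_add:
  "linear_between V W f \<Longrightarrow> x \<in> V \<Longrightarrow> y \<in> V \<Longrightarrow> f (x + y) = f x + f y"
  by (simp add: linear_between_def)

lemma linear_between_scaleR:
  "linear_between V W f \<Longrightarrow> x \<in> V \<Longrightarrow> f (c *\<^sub>R x) = c *\<^sub>R f x"
  by (simp add: linear_between_def)

lemma linear_between_zero:
  assumes "linear_between V W f" "subspace V"
  shows "f 0 = 0"
  using linear_between_scaleR[OF assms(1) subspace_0[OF assms(2)], of 0] by simp

lemma linear_between_diff:
  assumes "linear_between V W f" "subspace V" "x \<in> V" "y \<in> V"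
  shows "f (x - y) = f x - f y"
proof -
  have "f ((x - y) + y) = f (x - y) + f y"
    using assms by (intro linear_between_add[OF assms(1)]) (auto intro: subspace_diff)
  then show ?thesis by simp
qed

lemma linear_between_compose:
  "linear_between V W f \<Longrightarrow> linear_between W X g \<Longrightarrow> linear_between V X (g \<circ> f)"
  by (simp add: linear_between_def)

lemma linear_between_subset:
  "linear_between V W f \<Longrightarrow> V' \<subseteq> V \<Longrightarrow> W \<subseteq> W' \<Longrightarrow> linear_between V' W' f"
  unfolding linear_between_def by (meson subsetD)

lemma subspace_image_linear_between:
  assumes f: "linear_between V W f" and V: "subspace V"
  shows "subspace (f ` V)"
  unfolding subspace_def
proof (intro conjI ballI allI)
  show "0 \<in> f ` V"
    using linear_between_zero[OF f V] subspace_0[OF V] by (metis imageI)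
next
  fix x y assume "x \<in> f ` V" "y \<in> f ` V"
  then show "x + y \<in> f ` V"
    using linear_between_add[OF f] subspace_add[OF V] by (smt (verit) imageE imageI)
next
  fix c x assume "x \<in> f ` V"
  then show "c *\<^sub>R x \<in> f ` V"
    using linear_between_scaleR[OF f] subspace_scale[OF V] by (smt (verit) imageE imageI)
qed

lemma subspace_preimage_linear_between:
  assumes f: "linear_between V W f" and V: "subspace V" and U: "subspace U"
  shows "subspace {x \<in> V. f x \<in> U}"
  unfolding subspace_def
  using linear_between_zero[OF f V] linear_between_add[OF f] linear_between_scaleR[OF f]
    subspace_0[OF V] subspace_0[OF U] subspace_add[OF V] subspace_add[OF U]
    subspace_scale[OF V] subspace_scale[OF U]
  by auto

lemma isomorphic_Inn_linear_bij:
  assumes f: "linear_between V W f" and V: "subspace V"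
    and ker: "\<And>x. x \<in> V \<Longrightarrow> f x = 0 \<Longrightarrow> x = 0"
    and onto: "f ` V = W"
  shows "isomorphic_Inn V W"
proof -
  have inj: "inj_on f V"
  proof (rule inj_onI)
    fix x y assume "x \<in> V" "y \<in> V" "f x = f y"
    then show "x = y"
      using ker[of "x - y"] linear_between_diff[OF f V] subspace_diff[OF V] by auto
  qed
  let ?g = "inv_into V f"
  have g: "?g y \<in> V" "f (?g y) = y" if "y \<in> W" for y
    using that onto by (auto simp: inv_into_into f_inv_into_f)
  have g_eq: "?g (f x) = x" if "x \<in> V" for x
    using inv_into_f_f[OF inj that] .
  have "linear_between W V ?g"
    unfolding linear_between_def
  proof (intro conjI ballI allI)
    fix x y assume xy: "x \<in> W" "y \<in> W"
    show "?g (x + y) = ?g x + ?g y"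
      using g_eq[of "?g x + ?g y"] linear_between_add[OF f] g xy subspace_add[OF V] by simp
  next
    fix c x assume x: "x \<in> W"
    show "?g (c *\<^sub>R x) = c *\<^sub>R ?g x"
      using g_eq[of "c *\<^sub>R ?g x"] linear_between_scaleR[OF f] g x subspace_scale[OF V] by simp
  qed (use g in auto)
  then show ?thesis
    unfolding isomorphic_Inn_def using f g g_eq by blast
qed

section \<open>Adjoints and projections for finite-dimensional subspaces\<close>

definition fin_dim_subspace :: "'a::real_vector set \<Rightarrow> bool"
  where "fin_dim_subspace V \<longleftrightarrow> (\<exists>B. finite B \<and> V = span B)"

lemma fin_dim_subspace_imp_subspace: "fin_dim_subspace V \<Longrightarrow> subspace V"
  by (auto simp: fin_dim_subspace_def)

lemma fin_dim_subspace_subset: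
  assumes V: "fin_dim_subspace V" and U: "subspace U" "U \<subseteq> V"
  shows "fin_dim_subspace U"
proof -
  obtain B where B: "finite B" "V = span B"
    using V by (auto simp: fin_dim_subspace_def)
  obtain C where C: "C \<subseteq> U" "independent C" "U \<subseteq> span C"
    by (rule maximal_independent_subset)
  have "finite C"
    using independent_span_bound[OF B(1) C(2)] C(1) U(2) B(2) by auto
  moreover have "U = span C"
    using C U(1) by (simp add: span_minimal subset_antisym)
  ultimately show ?thesis
    by (auto simp: fin_dim_subspace_def)
qed

text \<open>
  Only the subspace is finite-dimensional, and the ambient space may be incomplete; the
  representing vector is therefore given by its Fourier coefficients in an orthogonal spanning set
  of the subspace.
\<close>

lemma riesz_representation_on:
  fixes V :: "'a::real_inner set" and f :: "'a \<Rightarrow> 'b::real_inner"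
  assumes V: "fin_dim_subspace V" and f: "linear_between V W f"
  shows "\<exists>x\<in>V. \<forall>v\<in>V. f v \<bullet> y = v \<bullet> x"
proof -
  obtain B where B: "finite B" "V = span B"
    using V by (auto simp: fin_dim_subspace_def)
  obtain C where C: "finite C" "span C = V" "pairwise orthogonal C"
    using basis_orthogonal[OF B(1)] B(2) by blast
  have sub: "subspace V"
    using V by (rule fin_dim_subspace_imp_subspace)
  define x where "x = (\<Sum>c\<in>C. ((f c \<bullet> y) / (c \<bullet> c)) *\<^sub>R c)"
  have x: "x \<in> V"
    unfolding x_def C(2)[symmetric] by (intro span_sum span_scale span_base)
  have basis: "f c \<bullet> y = c \<bullet> x" if c: "c \<in> C" for c
  proof -
    have "c \<bullet> x = (\<Sum>e\<in>C. ((f e \<bullet> y) / (e \<bullet> e)) * (c \<bullet> e))"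
      by (simp add: x_def inner_sum_right)
    also have "\<dots> = (\<Sum>e\<in>C. if e = c then ((f c \<bullet> y) / (c \<bullet> c)) * (c \<bullet> c) else 0)"
      using C(3) c by (intro sum.cong) (auto simp: pairwise_def orthogonal_def)
    also have "\<dots> = ((f c \<bullet> y) / (c \<bullet> c)) * (c \<bullet> c)"
      using C(1) c by simp
    \<comment> \<open>The spanning set may contain the zero vector; there the quotient is 0, and so is \<open>f c\<close>.\<close>
    also have "\<dots> = f c \<bullet> y"
      using linear_between_zero[OF f sub] by (cases "c = 0") auto
    finally show ?thesis by simp
  qed
  have "span C \<subseteq> {v \<in> V. f v \<bullet> y = v \<bullet> x}"
  proof (rule span_minimal)
    show "C \<subseteq> {v \<in> V. f v \<bullet> y = v \<bullet> x}"
      using basis C(2) span_superset[of C] by auto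
    show "subspace {v \<in> V. f v \<bullet> y = v \<bullet> x}"
      unfolding subspace_def
      using subspace_0[OF sub] subspace_add[OF sub] subspace_scale[OF sub]
        linear_between_zero[OF f sub] linear_between_add[OF f] linear_between_scaleR[OF f]
      by (auto simp: inner_add_left)
  qed
  then show ?thesis using x C(2) by blast
qed

lemma adjoint_on_eqI:
  assumes V: "subspace V" and x: "x \<in> V" "\<And>v. v \<in> V \<Longrightarrow> f v \<bullet> y = v \<bullet> x"
  shows "adjoint_on V f y = x"
  unfolding adjoint_on_def
proof (rule the_equality)
  fix z assume z: "z \<in> V \<and> (\<forall>v\<in>V. f v \<bullet> y = v \<bullet> z)"
  then have "z - x \<in> V" using subspace_diff[OF V] x(1) by blast
  then have "(z - x) \<bullet> z = (z - x) \<bullet> x" using x(2) z by metis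
  then have "(z - x) \<bullet> (z - x) = 0" by (simp add: inner_diff_right)
  then show "z = x" by simp
qed (use x in auto)

lemma
  assumes V: "fin_dim_subspace V" and f: "linear_between V W f"
  shows adjoint_on_mem: "adjoint_on V f y \<in> V"
    and adjoint_on_inner: "v \<in> V \<Longrightarrow> v \<bullet> adjoint_on V f y = f v \<bullet> y"
proof -
  obtain x where x: "x \<in> V" "\<And>v. v \<in> V \<Longrightarrow> f v \<bullet> y = v \<bullet> x"
    using riesz_representation_on[OF V f, of y] by blast
  have "adjoint_on V f y = x"
    using adjoint_on_eqI[of V x f y] fin_dim_subspace_imp_subspace[OF V] x by blast
  with x show "adjoint_on V f y \<in> V" and "v \<in> V \<Longrightarrow> v \<bullet> adjoint_on V f y = f v \<bullet> y"
    by auto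
qed

lemma linear_between_adjoint_on:
  assumes V: "fin_dim_subspace V" and f: "linear_between V W f"
  shows "linear_between X V (adjoint_on V f)"
proof -
  note sub = fin_dim_subspace_imp_subspace[OF V]
  note mem = adjoint_on_mem[OF V f] and adj = adjoint_on_inner[OF V f]
  show ?thesis
    unfolding linear_between_def
    by (intro conjI ballI allI mem adjoint_on_eqI[OF sub] subspace_add[OF sub] subspace_scale[OF sub])
       (simp_all add: inner_add_right adj)
qed

text \<open>
  The projection onto a subspace is the adjoint of its inclusion, so its existence, uniqueness and
  linearity are instances of the facts about adjoints.
\<close>

lemma orth_projection_eq_adjoint_on:
  fixes U :: "'a::real_inner set"
  shows "orth_projection U = adjoint_on U id"
proof (rule ext)
  fix x :: 'a
  have "orthogonal (x - u) v \<longleftrightarrow> id v \<bullet> x = v \<bullet> u" for u v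
    by (simp add: orthogonal_def inner_diff_left inner_commute[of v])
  then show "orth_projection U x = adjoint_on U id x"
    by (simp add: orth_projection_def adjoint_on_def)
qed

lemma linear_between_id: "linear_between U U id"
  by (simp add: linear_between_def)

lemma linear_between_orth_projection:
  "fin_dim_subspace U \<Longrightarrow> linear_between X U (orth_projection U)"
  unfolding orth_projection_eq_adjoint_on by (rule linear_between_adjoint_on[OF _ linear_between_id])

lemma orth_projection_mem: "fin_dim_subspace U \<Longrightarrow> orth_projection U x \<in> U"
  unfolding orth_projection_eq_adjoint_on by (rule adjoint_on_mem[OF _ linear_between_id])

lemma orth_projection_inner:
  "fin_dim_subspace U \<Longrightarrow> v \<in> U \<Longrightarrow> v \<bullet> orth_projection U x = v \<bullet> x"
  unfolding orth_projection_eq_adjoint_on using adjoint_on_inner[OF _ linear_between_id] by simp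

lemma orth_projection_eq_self: "subspace U \<Longrightarrow> x \<in> U \<Longrightarrow> orth_projection U x = x"
  unfolding orth_projection_eq_adjoint_on by (rule adjoint_on_eqI) auto

lemma orth_projection_eq_zero:
  "subspace U \<Longrightarrow> (\<And>v. v \<in> U \<Longrightarrow> v \<bullet> x = 0) \<Longrightarrow> orth_projection U x = 0"
  unfolding orth_projection_eq_adjoint_on by (rule adjoint_on_eqI) (auto simp: subspace_0)

section \<open>Hodge theory of a two-step complex\<close>

text \<open>
  Pairing \<open>A A* x + d* d x\<close> with \<open>x\<close> gives the sum of the squared norms of \<open>A* x\<close> and \<open>d x\<close>, so
  both vanish on the kernel; and \<open>A* x = 0\<close> says that \<open>x\<close> is orthogonal to \<open>im A\<close>.
\<close>

lemma kernel_two_step_laplacian: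
  assumes P: "fin_dim_subspace P" and V: "fin_dim_subspace V"
    and A: "linear_between P V A" and d: "linear_between V W d"
  shows "kernel_on V (\<lambda>x. A (adjoint_on P A x) + adjoint_on V d (d x))
         = {x \<in> V. d x = 0 \<and> (\<forall>p\<in>P. A p \<bullet> x = 0)}" (is "?K = ?R")
proof (rule set_eqI)
  fix x
  note subP = fin_dim_subspace_imp_subspace[OF P] and subV = fin_dim_subspace_imp_subspace[OF V]
  note memP = adjoint_on_mem[OF P A] and adjP = adjoint_on_inner[OF P A]
    and adjV = adjoint_on_inner[OF V d]
  show "x \<in> ?K \<longleftrightarrow> x \<in> ?R"
  proof
    assume K: "x \<in> ?K"
    then have x: "x \<in> V" and "A (adjoint_on P A x) + adjoint_on V d (d x) = 0"
      by (auto simp: kernel_on_def)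
    then have "x \<bullet> A (adjoint_on P A x) + x \<bullet> adjoint_on V d (d x) = 0"
      by (metis inner_add_right inner_zero_right)
    moreover have "x \<bullet> A (adjoint_on P A x) = adjoint_on P A x \<bullet> adjoint_on P A x"
      using adjP[OF memP, of x x] by (simp add: inner_commute)
    ultimately have sum0: "adjoint_on P A x \<bullet> adjoint_on P A x + d x \<bullet> d x = 0"
      using adjV[OF x] by simp
    have "adjoint_on P A x = 0" "d x = 0"
      using sum0 by (simp_all add: add_nonneg_eq_0_iff)
    moreover have "A p \<bullet> x = 0" if "p \<in> P" for p
      using adjP[OF that, of x] \<open>adjoint_on P A x = 0\<close> by simp
    ultimately show "x \<in> ?R" using x by simp
  next
    assume R: "x \<in> ?R"
    then have "adjoint_on P A x = 0"
      by (intro adjoint_on_eqI[OF subP]) (auto simp: subspace_0[OF subP])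
    moreover have "adjoint_on V d 0 = 0"
      by (intro adjoint_on_eqI[OF subV]) (auto simp: subspace_0[OF subV])
    ultimately show "x \<in> ?K"
      using R linear_between_zero[OF A subP] by (simp add: kernel_on_def)
  qed
qed

lemma orthogonal_direct_sum_subspace: "orthogonal_direct_sum I U V \<Longrightarrow> i \<in> I \<Longrightarrow> subspace (U i)"
  by (simp add: orthogonal_direct_sum_def)

lemma orthogonal_direct_sum_three:
  assumes "subspace X" "subspace Y" "subspace Z"
    and "\<And>x y. x \<in> X \<Longrightarrow> y \<in> Y \<Longrightarrow> x \<bullet> y = 0"
    and "\<And>x z. x \<in> X \<Longrightarrow> z \<in> Z \<Longrightarrow> x \<bullet> z = 0"
    and "\<And>y z. y \<in> Y \<Longrightarrow> z \<in> Z \<Longrightarrow> y \<bullet> z = 0"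
    and "V = span (X \<union> Y \<union> Z)"
  shows "orthogonal_direct_sum {..<3::nat} ((!) [X, Y, Z]) V"
proof -
  have three: "{..<3::nat} = {0, 1, 2}" by auto
  have "y \<bullet> x = 0" if "x \<in> X" "y \<in> Y" for x y
    using assms(4)[OF that] by (simp add: inner_commute)
  moreover have "z \<bullet> x = 0" if "x \<in> X" "z \<in> Z" for x z
    using assms(5)[OF that] by (simp add: inner_commute)
  moreover have "z \<bullet> y = 0" if "y \<in> Y" "z \<in> Z" for y z
    using assms(6)[OF that] by (simp add: inner_commute)
  ultimately show ?thesis
    unfolding orthogonal_direct_sum_def three orthogonal_def
    using assms by (auto simp: Un_assoc)
qed

text \<open>
  Orthogonality of the two images is \<open>d A = 0\<close>.  The three summands exhaust \<open>V\<close> because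
  a vector \<open>z\<close> orthogonal to all of them is orthogonal to \<open>A A* z\<close> and \<open>d* d z\<close>,
  hence lies in the kernel, and so is orthogonal to itself.
\<close>

lemma two_step_hodge_decomposition:
  assumes P: "fin_dim_subspace P" and V: "fin_dim_subspace V"
    and A: "linear_between P V A" and d: "linear_between V W d"
    and dA: "\<And>p. p \<in> P \<Longrightarrow> d (A p) = 0"
  defines "up \<equiv> A \<circ> adjoint_on P A" and "down \<equiv> adjoint_on V d \<circ> d"
  shows "orthogonal_direct_sum {..<3::nat}
           ((!) [kernel_on V (\<lambda>x. up x + down x), up ` V, down ` V]) V"
proof -
  note subP = fin_dim_subspace_imp_subspace[OF P] and subV = fin_dim_subspace_imp_subspace[OF V]
  note memP = adjoint_on_mem[OF P A] and adjP = adjoint_on_inner[OF P A]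
    and memV = adjoint_on_mem[OF V d] and adjV = adjoint_on_inner[OF V d]
  let ?K = "kernel_on V (\<lambda>x. up x + down x)"
  have K: "?K = {x \<in> V. d x = 0 \<and> (\<forall>p\<in>P. A p \<bullet> x = 0)}"
    using kernel_two_step_laplacian[OF P V A d] by (simp add: up_def down_def)
  have up: "linear_between V V up"
    unfolding up_def by (rule linear_between_compose[OF linear_between_adjoint_on[OF P A] A])
  have down: "linear_between V V down"
    unfolding down_def by (rule linear_between_compose[OF d linear_between_adjoint_on[OF V d]])
  have subK: "subspace ?K"
    unfolding K subspace_def
    using subspace_0[OF subV] subspace_add[OF subV] subspace_scale[OF subV]
      linear_between_zero[OF d subV] linear_between_add[OF d] linear_between_scaleR[OF d]
    by (auto simp: inner_add_right)
  let ?U = "span (?K \<union> up ` V \<union> down ` V)"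
  have U_sub: "?U \<subseteq> V"
    using linear_between_mem[OF up] linear_between_mem[OF down]
    by (intro span_minimal subV) (auto simp: kernel_on_def)
  have fU: "fin_dim_subspace ?U"
    by (rule fin_dim_subspace_subset[OF V _ U_sub]) simp
  have "V \<subseteq> ?U"
  proof
    fix x assume x: "x \<in> V"
    define u where "u = orth_projection ?U x"
    define z where "z = x - u"
    have u: "u \<in> ?U" unfolding u_def by (rule orth_projection_mem[OF fU])
    have z: "z \<in> V" unfolding z_def using subspace_diff[OF subV x] u U_sub by blast
    have perp: "v \<bullet> z = 0" if "v \<in> ?U" for v
      using orth_projection_inner[OF fU that, of x] by (simp add: z_def u_def inner_diff_right)
    have "up z \<bullet> z = 0" "down z \<bullet> z = 0"
      using z by (auto intro!: perp span_base)
    then have "adjoint_on P A z \<bullet> adjoint_on P A z = 0" "d z \<bullet> d z = 0"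
      using adjP[OF memP, of z z] adjV[OF z, of "d z"]
      by (simp_all add: up_def down_def inner_commute)
    then have "adjoint_on P A z = 0" and dz: "d z = 0" by simp_all
    then have "A p \<bullet> z = 0" if "p \<in> P" for p
      using adjP[OF that, of z] by simp
    with dz z have "z \<in> ?K" unfolding K by blast
    then have "z \<bullet> z = 0" by (intro perp span_base) blast
    then have "x = u" by (simp add: z_def)
    then show "x \<in> ?U" using u by simp
  qed
  with U_sub have V_eq: "V = ?U" by blast
  show ?thesis
  proof (rule orthogonal_direct_sum_three[OF subK])
    show "subspace (up ` V)" "subspace (down ` V)"
      by (rule subspace_image_linear_between[OF up subV] subspace_image_linear_between[OF down subV])+
  next
    fix x y assume "x \<in> ?K" "y \<in> up ` V"
    then show "x \<bullet> y = 0"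
      using memP unfolding K by (auto simp: up_def inner_commute)
  next
    fix x z assume "x \<in> ?K" "z \<in> down ` V"
    then show "x \<bullet> z = 0"
      using adjV unfolding K by (auto simp: down_def)
  next
    fix y z assume "y \<in> up ` V" "z \<in> down ` V"
    then show "y \<bullet> z = 0"
      using adjV[OF linear_between_mem[OF A memP]] dA[OF memP] by (auto simp: up_def down_def)
  qed (rule V_eq)
qed

section \<open>Harmonic elements\<close>

lemma dgi_fin_dim: "dgi V \<Longrightarrow> fin_dim_subspace (total_space V)"
  by (auto simp: dgi_def fin_dim_subspace_def)

lemma dgi_bdry: "dgi V \<Longrightarrow> linear_between (total_space V) (total_space V) (bdry V)"
  by (simp add: dgi_def)

lemma harmonic_iff:
  assumes V: "dgi V"
  shows "x \<in> harmonic V \<longleftrightarrow>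
    x \<in> total_space V \<and> bdry V x = 0 \<and> (\<forall>y\<in>total_space V. bdry V y \<bullet> x = 0)"
proof -
  note fin = dgi_fin_dim[OF V] and d = dgi_bdry[OF V]
  note sub = fin_dim_subspace_imp_subspace[OF fin]
  have "bdry_adj V x = 0 \<longleftrightarrow> (\<forall>y\<in>total_space V. bdry V y \<bullet> x = 0)"
    unfolding bdry_adj_def
    using adjoint_on_inner[OF fin d, of _ x] adjoint_on_eqI[OF sub subspace_0[OF sub], of "bdry V" x]
    by (metis inner_zero_right)
  then show ?thesis by (auto simp: harmonic_def kernel_on_def)
qed

lemma fin_dim_harmonic:
  assumes V: "dgi V"
  shows "fin_dim_subspace (harmonic V)"
proof (rule fin_dim_subspace_subset[OF dgi_fin_dim[OF V]])
  note d = dgi_bdry[OF V] and sub = fin_dim_subspace_imp_subspace[OF dgi_fin_dim[OF V]]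
  show "subspace (harmonic V)"
    unfolding subspace_def
    using subspace_0[OF sub] subspace_add[OF sub] subspace_scale[OF sub]
      linear_between_zero[OF d sub] linear_between_add[OF d] linear_between_scaleR[OF d]
    by (auto simp: harmonic_iff[OF V] inner_add_right)
  show "harmonic V \<subseteq> total_space V"
    by (auto simp: harmonic_iff[OF V])
qed

lemma harmonic_proj_image:
  assumes V: "dgi V"
  shows "harmonic_proj V ` total_space V = harmonic V"
proof -
  note fin = fin_dim_harmonic[OF V]
  have "harmonic V \<subseteq> harmonic_proj V ` total_space V"
  proof
    fix x assume x: "x \<in> harmonic V"
    then have "x \<in> total_space V" by (simp add: harmonic_iff[OF V])
    moreover have "harmonic_proj V x = x"
      unfolding harmonic_proj_def using fin_dim_subspace_imp_subspace[OF fin] x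
      by (rule orth_projection_eq_self)
    ultimately show "x \<in> harmonic_proj V ` total_space V" by force
  qed
  then show ?thesis
    using orth_projection_mem[OF fin] by (auto simp: harmonic_proj_def)
qed

lemma harmonic_proj_boundary:
  assumes V: "dgi V" and y: "y \<in> total_space V"
  shows "harmonic_proj V (bdry V y) = 0"
  unfolding harmonic_proj_def
  using y by (intro orth_projection_eq_zero fin_dim_subspace_imp_subspace[OF fin_dim_harmonic[OF V]])
    (auto simp: harmonic_iff[OF V] inner_commute)

text \<open>
  The part of the cycle orthogonal to all boundaries is harmonic, and the whole cycle is orthogonal
  to harmonic elements; so that part is orthogonal to itself.
\<close>

lemma cycle_with_zero_harmonic_proj:
  assumes V: "dgi V" and w: "w \<in> total_space V" "bdry V w = 0" "harmonic_proj V w = 0"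
  shows "w \<in> bdry V ` total_space V"
proof -
  note fin = dgi_fin_dim[OF V] and d = dgi_bdry[OF V]
  note sub = fin_dim_subspace_imp_subspace[OF fin]
  let ?B = "bdry V ` total_space V"
  have fB: "fin_dim_subspace ?B"
    using linear_between_mem[OF d]
    by (intro fin_dim_subspace_subset[OF fin subspace_image_linear_between[OF d sub]]) auto
  define r where "r = orth_projection ?B w"
  have r: "r \<in> ?B" unfolding r_def by (rule orth_projection_mem[OF fB])
  then have r': "r \<in> total_space V" "bdry V r = 0"
    using V linear_between_mem[OF d] by (auto simp: dgi_def)
  have perp: "v \<bullet> (w - r) = 0" if "v \<in> ?B" for v
    using orth_projection_inner[OF fB that, of w] by (simp add: r_def inner_diff_right)
  have "w - r \<in> harmonic V"
    using w r' perp linear_between_diff[OF d sub w(1) r'(1)] subspace_diff[OF sub w(1) r'(1)]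
    by (auto simp: harmonic_iff[OF V])
  then have "(w - r) \<bullet> w = 0"
    using orth_projection_inner[OF fin_dim_harmonic[OF V], of "w - r" w] w(3)
    by (simp add: harmonic_proj_def)
  moreover have "(w - r) \<bullet> r = 0"
    using perp[OF r] by (simp add: inner_commute)
  ultimately have "(w - r) \<bullet> (w - r) = 0"
    by (simp add: inner_diff_right)
  then show ?thesis using r by simp
qed

section \<open>The persistent Laplacian\<close>

theorem theorem1p2:
  fixes S :: "real \<Rightarrow> 'a::real_inner dg_space"
    and f :: "real \<Rightarrow> real \<Rightarrow> 'a \<Rightarrow> 'a"
    and a b :: real
  assumes "persistence_dgi S f"
    and "a \<le> b"
  shows "orthogonal_direct_sum {..<3::nat}
           ((!) [kernel_on (total_space (S a)) (persistent_laplacian S f a b),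
                 persistent_up S f a b ` total_space (S a),
                 (bdry_adj (S a) \<circ> bdry (S a)) ` total_space (S a)])
           (total_space (S a)) \<and>
         isomorphic_Inn
           (kernel_on (total_space (S a)) (persistent_laplacian S f a b))
           (persistent_harmonic S f a b)"
proof -
  define V where "V = total_space (S a)"
  define W where "W = total_space (S b)"
  define d where "d = bdry (S a)"
  define e where "e = bdry (S b)"
  define F where "F = f a b"
  define P where "P = persistent_dom S f a b"
  define h where "h = harmonic_proj (S b)"
  define A where "A = adjoint_on V F \<circ> e"
  note defs = V_def W_def d_def e_def F_def P_def h_def
  have Sa: "dgi (S a)" and Sb: "dgi (S b)" and mor: "dgi_morphism (S a) (S b) F"
    using assms by (auto simp: persistence_dgi_def F_def)
  have V: "fin_dim_subspace V" and W: "fin_dim_subspace W"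
    using dgi_fin_dim Sa Sb by (auto simp: defs)
  note subV = fin_dim_subspace_imp_subspace[OF V] and subW = fin_dim_subspace_imp_subspace[OF W]
  have d: "linear_between V V d" and e: "linear_between W W e"
    using dgi_bdry Sa Sb by (auto simp: defs)
  have ee: "e (e x) = 0" if "x \<in> W" for x
    using Sb that by (auto simp: dgi_def defs)
  have F: "linear_between V W F" and chain: "\<And>x. x \<in> V \<Longrightarrow> F (d x) = e (F x)"
    and iso: "\<And>x y. x \<in> V \<Longrightarrow> y \<in> V \<Longrightarrow> F x \<bullet> F y = x \<bullet> y"
    using mor by (auto simp: dgi_morphism_def defs)
  have F_zero: "x = 0" if "x \<in> V" "F x = 0" for x
    using iso[of x x] that by simp

  have P_eq: "P = {x \<in> W. e x \<in> F ` V}"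
    by (simp add: persistent_dom_def defs)
  have P_sub: "P \<subseteq> W" by (auto simp: P_eq)
  have "subspace P"
    unfolding P_eq
    by (rule subspace_preimage_linear_between[OF e subW subspace_image_linear_between[OF F subV]])
  then have P: "fin_dim_subspace P"
    using P_sub by (rule fin_dim_subspace_subset[OF W])
  have A: "linear_between P V A"
    unfolding A_def
    by (rule linear_between_compose[OF linear_between_subset[OF e P_sub subset_refl]
          linear_between_adjoint_on[OF V F]])
  have FA: "F (A p) = e p" if p: "p \<in> P" for p
  proof -
    obtain v where v: "v \<in> V" "e p = F v" using p by (auto simp: P_eq)
    have "adjoint_on V F (F v) = v"
      by (rule adjoint_on_eqI[OF subV v(1)]) (rule iso[OF _ v(1)])
    then show ?thesis by (simp add: A_def v(2))
  qed
  have dA: "d (A p) = 0" if p: "p \<in> P" for p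
  proof (rule F_zero)
    have Ap: "A p \<in> V" using linear_between_mem[OF A p] .
    then show "d (A p) \<in> V" by (rule linear_between_mem[OF d])
    show "F (d (A p)) = 0"
      using chain[OF Ap] FA[OF p] ee p P_sub by auto
  qed

  have A_adj: "adjoint_on P A x = adjoint_on P id (adjoint_on W e (F x))" if x: "x \<in> V" for x
  proof (rule adjoint_on_eqI[OF \<open>subspace P\<close>])
    show "adjoint_on P id (adjoint_on W e (F x)) \<in> P"
      by (rule adjoint_on_mem[OF P linear_between_id])
    fix p assume p: "p \<in> P"
    have "A p \<bullet> x = e p \<bullet> F x"
      using adjoint_on_inner[OF V F x, of "e p"] by (simp add: A_def inner_commute)
    then show "A p \<bullet> x = p \<bullet> adjoint_on P id (adjoint_on W e (F x))"
      using adjoint_on_inner[OF P linear_between_id p, of "adjoint_on W e (F x)"]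
        adjoint_on_inner[OF W e, of p "F x"] p P_sub by auto
  qed
  have up_eq: "persistent_up S f a b x = (A \<circ> adjoint_on P A) x" if "x \<in> V" for x
    using A_adj[OF that] by (simp add: persistent_up_def bdry_adj_def A_def flip: defs)
  have up_image: "persistent_up S f a b ` V = (A \<circ> adjoint_on P A) ` V"
    by (rule image_cong[OF refl up_eq])
  have down_eq: "bdry_adj (S a) \<circ> bdry (S a) = adjoint_on V d \<circ> d"
    by (simp add: bdry_adj_def defs)
  have ker_eq: "kernel_on V (persistent_laplacian S f a b)
      = kernel_on V (\<lambda>x. (A \<circ> adjoint_on P A) x + (adjoint_on V d \<circ> d) x)"
    using up_eq by (auto simp: kernel_on_def persistent_laplacian_def bdry_adj_def simp flip: defs)
  let ?K = "kernel_on V (persistent_laplacian S f a b)"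
  have decomp: "orthogonal_direct_sum {..<3::nat}
      ((!) [?K, persistent_up S f a b ` V, (bdry_adj (S a) \<circ> bdry (S a)) ` V]) V"
    unfolding ker_eq down_eq up_image
    by (rule two_step_hodge_decomposition[OF P V A d dA])

  have K: "?K = {x \<in> V. d x = 0 \<and> (\<forall>p\<in>P. A p \<bullet> x = 0)}"
    using kernel_two_step_laplacian[OF P V A d] unfolding ker_eq by simp
  have subK: "subspace ?K"
    using orthogonal_direct_sum_subspace[OF decomp, of 0] by simp
  have imA: "v \<in> A ` P" if v: "v \<in> V" "F v \<in> e ` W" for v
  proof -
    obtain w where w: "w \<in> W" "F v = e w" using v(2) by blast
    then have p: "w \<in> P" using v(1) by (auto simp: P_eq intro: rev_image_eqI)
    have Aw: "A w \<in> V" using linear_between_mem[OF A p] .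
    have "F (v - A w) = 0"
      using linear_between_diff[OF F subV v(1) Aw] FA[OF p] w by simp
    then have "v = A w"
      using F_zero[OF subspace_diff[OF subV v(1) Aw]] by simp
    then show ?thesis using p by blast
  qed
  have hF: "linear_between V (harmonic (S b)) (h \<circ> F)"
    unfolding h_def harmonic_proj_def
    by (rule linear_between_compose[OF F linear_between_orth_projection[OF fin_dim_harmonic[OF Sb]]])
  have PH: "persistent_harmonic S f a b = (h \<circ> F) ` harmonic (S a)"
    unfolding persistent_harmonic_def image_comp[symmetric] harmonic_proj_image[OF Sa]
    by (simp add: h_def F_def image_comp)

  have onto: "(h \<circ> F) ` ?K = (h \<circ> F) ` harmonic (S a)"
  proof
    \<comment> \<open>A boundary \<open>d y\<close> of \<open>V\<close> satisfies \<open>F (d y) = e (F y)\<close>, so it belongs to \<open>im A\<close>.\<close>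
    have "?K \<subseteq> harmonic (S a)"
    proof
      fix x assume x: "x \<in> ?K"
      have "d y \<bullet> x = 0" if y: "y \<in> V" for y
      proof -
        have "d y \<in> A ` P"
          using imA[OF linear_between_mem[OF d y]] chain[OF y] linear_between_mem[OF F y] by auto
        then show ?thesis using x by (auto simp: K)
      qed
      then show "x \<in> harmonic (S a)"
        using x by (auto simp: K harmonic_iff[OF Sa] simp flip: defs)
    qed
    then show "(h \<circ> F) ` ?K \<subseteq> (h \<circ> F) ` harmonic (S a)" by blast
  next
    show "(h \<circ> F) ` harmonic (S a) \<subseteq> (h \<circ> F) ` ?K"
    proof
      fix y assume "y \<in> (h \<circ> F) ` harmonic (S a)"
      then obtain u where u: "u \<in> V" "d u = 0" "y = (h \<circ> F) u"
        by (auto simp: harmonic_iff[OF Sa] defs)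
      have fA: "fin_dim_subspace (A ` P)"
        using linear_between_mem[OF A]
        by (intro fin_dim_subspace_subset[OF V subspace_image_linear_between[OF A \<open>subspace P\<close>]]) auto
      obtain p where p: "p \<in> P" "orth_projection (A ` P) u = A p"
        using orth_projection_mem[OF fA, of u] by blast
      define v where "v = u - A p"
      have Ap: "A p \<in> V" using linear_between_mem[OF A p(1)] .
      have v: "v \<in> V" unfolding v_def by (rule subspace_diff[OF subV u(1) Ap])
      have "d v = 0"
        using linear_between_diff[OF d subV u(1) Ap] u(2) dA[OF p(1)] by (simp add: v_def)
      moreover have "A q \<bullet> v = 0" if "q \<in> P" for q
        using orth_projection_inner[OF fA, of "A q" u] that p(2)
        by (simp add: v_def inner_diff_right)
      ultimately have vK: "v \<in> ?K" using v by (simp add: K)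
      have "h (F (A p)) = 0"
        unfolding FA[OF p(1)] unfolding h_def e_def
        using harmonic_proj_boundary[OF Sb] p(1) P_sub by (auto simp: W_def)
      then have "(h \<circ> F) v = y"
        unfolding v_def linear_between_diff[OF hF subV u(1) Ap] using u(3) by simp
      then show "y \<in> (h \<circ> F) ` ?K" using vK by blast
    qed
  qed
  have "isomorphic_Inn ?K (persistent_harmonic S f a b)"
  proof (rule isomorphic_Inn_linear_bij[OF _ subK])
    show "(h \<circ> F) ` ?K = persistent_harmonic S f a b"
      using onto PH by simp
    show "linear_between ?K (persistent_harmonic S f a b) (h \<circ> F)"
      unfolding PH onto[symmetric] using hF by (auto simp: linear_between_def K)
    fix x assume x: "x \<in> ?K" "(h \<circ> F) x = 0"
    then have xV: "x \<in> V" and dx: "d x = 0" by (auto simp: K)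
    have "e (F x) = 0"
      using chain[OF xV] dx linear_between_zero[OF F subV] by simp
    then have "F x \<in> e ` W"
      using cycle_with_zero_harmonic_proj[OF Sb, of "F x"] linear_between_mem[OF F xV] x(2)
      by (simp add: defs)
    then have "x \<in> A ` P" using imA[OF xV] by blast
    then have "x \<bullet> x = 0" using x(1) by (auto simp: K)
    then show "x = 0" by simp
  qed
  with decomp show ?thesis by (simp add: V_def)
qed

end
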